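(* Let $M\subset\mathbb{R}^3$ be an open neighborhood of $0$, let $f:M\to\mathbb{R}^2$ be a $C^\infty$ map, let $D_1\subset TM$ be a rank $2$ tangent distribution with frame $\{e_1,e_2\}$ on $M$ such that $e_1f$ is nowhere zero on $M$, and let $\varphi:D_1\to f^*T\mathbb{R}^2$, $\varphi(v)=df(v)$, be the bundle homomorphism induced by $f$. Let $p\in M$ be a singular point of $\varphi$ (so $\operatorname{rank}\varphi_p=1$) and let $\eta_\varphi$ be a null section of $\varphi$ near $p$. Then: (i) $p$ is a fold-like singular point of $\varphi$ if and only if $\det(e_1f,\eta_\varphi^2f)\neq0$ at $p$. (ii) If $p$ is non-degenerate, then $p$ is a cusp-like singular point of $\varphi$ if and only if $\det(e_1f,\eta_\varphi^2f)=0$ and $\det(e_1f,\eta_\varphi^3f)\neq0$ at $p$. (iii) If $p$ is non-degenerate, then $p$ is a swallowtail-like singular point of $\varphi$ if and only if $\det(e_1f,\eta_\varphi^2f)=\det(e_1f,\eta_\varphi^3f)=0$, $\det(e_1f,\eta_\varphi^4f)\neq0$ at $p$, and $$\det d\big(\det(e_1f,\eta_\varphi f),\ \det(e_1f,\eta_\varphi^2f),\ \det(e_1f,\eta_\varphi^3f)\big)\neq0\quad\text{at }p,$$ where $d(\cdot,\cdot,\cdot)$ denotes the $3\times 3$ Jacobian matrix.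
   Context: For a vector field $\xi$ and a (vector-valued) function $g$, $\xi g$ is the directional derivative and $\xi^ig$ the $i$-times iterated directional derivative. With respect to $\{e_1,e_2\}$ and the trivial frame of $\mathbb{R}^2$, $\varphi$ is represented by the matrix $(e_1f,e_2f)$; put $\lambda_\varphi=\det(e_1f,e_2f)$. The set $S$ of singular points of $\varphi$ (points where $\operatorname{rank}\varphi_p<2$) is $\{\lambda_\varphi=0\}$. A singular point $p$ is of corank one if $\operatorname{rank}\varphi_p=1$, and non-degenerate if $d\lambda_\varphi(p)\neq0$. A null section of $\varphi$ near a corank one singular point $p$ is a smooth section $\eta_\varphi$ of $D_1$ on a neighborhood $U$ of $p$ such that $(\eta_\varphi)_q$ generates $\ker\varphi_q$ for all $q\in S\cap U$. A singular point $p$ is fold-like if it is of corank one and $\eta_\varphi\lambda_\varphi(p)\ne0$; cusp-like if it is non-degenerate, $\eta_\varphi\lambda_\varphi(p)=0$ and $\eta_\varphi^2\lambda_\varphi(p)\ne0$; swallowtail-like if it is non-degenerate, $\eta_\varphi\lambda_\varphi(p)=\eta_\varphi^2\lambda_\varphi(p)=0$ and $\operatorname{rank}d(\lambda_\varphi,\eta_\varphi\lambda_\varphi,\eta_\varphi^2\lambda_\varphi)=3$ at $p$. (These notions do not depend on the choices of frames and null section.) *)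

theory Defs
  imports "HOL-Analysis.Analysis"
begin

text \<open>Only meant for open \<open>S\<close>. In finite dimension, \<open>C\<^sup>k\<close> is equivalent to all directional
  derivatives along constant vectors being \<open>C\<^sup>k\<^sup>-\<^sup>1\<close>, together with differentiability.\<close>

primrec Ck_on ::
  "nat \<Rightarrow> ('a::euclidean_space \<Rightarrow> 'b::real_normed_vector) \<Rightarrow> 'a set \<Rightarrow> bool" where
  "Ck_on 0 g S \<longleftrightarrow> continuous_on S g"
| "Ck_on (Suc k) g S \<longleftrightarrow> (\<forall>x\<in>S. g differentiable (at x)) \<and>
     (\<forall>v. Ck_on k (\<lambda>x. frechet_derivative g (at x) v) S)"

definition smooth_on ::
  "('a::euclidean_space \<Rightarrow> 'b::real_normed_vector) \<Rightarrow> 'a set \<Rightarrow> bool" where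
  "smooth_on g S \<longleftrightarrow> (\<forall>k. Ck_on k g S)"

text \<open>The iterated derivative \<open>\<xi>\<^sup>i g\<close> is \<open>(dir_deriv \<xi> ^^ i) g\<close>.\<close>

definition dir_deriv ::
  "('a::euclidean_space \<Rightarrow> 'a) \<Rightarrow> ('a \<Rightarrow> 'b::real_normed_vector) \<Rightarrow> 'a \<Rightarrow> 'b" where
  "dir_deriv \<xi> g q = frechet_derivative g (at q) (\<xi> q)"

definition det_cols :: "real ^ 2 \<Rightarrow> real ^ 2 \<Rightarrow> real" where
  "det_cols a b = det (transpose (vector [a, b] :: real ^ 2 ^ 2))"

text \<open>A distribution is given by its fibres \<open>D q\<close>, identifying each tangent space with \<open>\<real>\<^sup>3\<close>.
  Having a smooth frame on \<open>M\<close> makes \<open>D\<close> a smooth rank 2 distribution on \<open>M\<close>.\<close>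

definition rank2_distribution_with_frame ::
  "(real ^ 3) set \<Rightarrow> (real ^ 3 \<Rightarrow> (real ^ 3) set) \<Rightarrow>
   (real ^ 3 \<Rightarrow> real ^ 3) \<Rightarrow> (real ^ 3 \<Rightarrow> real ^ 3) \<Rightarrow> bool" where
  "rank2_distribution_with_frame M D e1 e2 \<longleftrightarrow>
     smooth_on e1 M \<and> smooth_on e2 M \<and>
     (\<forall>q\<in>M. e1 q \<noteq> e2 q \<and> independent {e1 q, e2 q} \<and> D q = span {e1 q, e2 q})"

text \<open>The fibre of the bundle homomorphism at \<open>q\<close> is the restriction of
  \<open>frechet_derivative f (at q)\<close> to \<open>D q\<close>.\<close>

definition hom_rank ::
  "(real ^ 3 \<Rightarrow> real ^ 2) \<Rightarrow> (real ^ 3 \<Rightarrow> (real ^ 3) set) \<Rightarrow> real ^ 3 \<Rightarrow> nat" where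
  "hom_rank f D q = dim (frechet_derivative f (at q) ` D q)"

definition hom_ker ::
  "(real ^ 3 \<Rightarrow> real ^ 2) \<Rightarrow> (real ^ 3 \<Rightarrow> (real ^ 3) set) \<Rightarrow> real ^ 3 \<Rightarrow> (real ^ 3) set" where
  "hom_ker f D q = {v \<in> D q. frechet_derivative f (at q) v = 0}"

definition singular_set ::
  "(real ^ 3) set \<Rightarrow> (real ^ 3 \<Rightarrow> real ^ 2) \<Rightarrow> (real ^ 3 \<Rightarrow> (real ^ 3) set) \<Rightarrow> (real ^ 3) set" where
  "singular_set M f D = {q \<in> M. hom_rank f D q < 2}"

definition corank_one ::
  "(real ^ 3) set \<Rightarrow> (real ^ 3 \<Rightarrow> real ^ 2) \<Rightarrow> (real ^ 3 \<Rightarrow> (real ^ 3) set) \<Rightarrow> real ^ 3 \<Rightarrow> bool" where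
  "corank_one M f D p \<longleftrightarrow> p \<in> singular_set M f D \<and> hom_rank f D p = 1"

definition lambda_hom ::
  "(real ^ 3 \<Rightarrow> real ^ 2) \<Rightarrow> (real ^ 3 \<Rightarrow> real ^ 3) \<Rightarrow> (real ^ 3 \<Rightarrow> real ^ 3) \<Rightarrow> real ^ 3 \<Rightarrow> real" where
  "lambda_hom f e1 e2 q = det_cols (dir_deriv e1 f q) (dir_deriv e2 f q)"

definition non_degenerate ::
  "(real ^ 3) set \<Rightarrow> (real ^ 3 \<Rightarrow> real ^ 2) \<Rightarrow> (real ^ 3 \<Rightarrow> (real ^ 3) set) \<Rightarrow>
   (real ^ 3 \<Rightarrow> real ^ 3) \<Rightarrow> (real ^ 3 \<Rightarrow> real ^ 3) \<Rightarrow> real ^ 3 \<Rightarrow> bool" where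
  "non_degenerate M f D e1 e2 p \<longleftrightarrow> p \<in> singular_set M f D \<and>
     frechet_derivative (lambda_hom f e1 e2) (at p) \<noteq> (\<lambda>v. 0)"

definition null_section ::
  "(real ^ 3) set \<Rightarrow> (real ^ 3 \<Rightarrow> real ^ 2) \<Rightarrow> (real ^ 3 \<Rightarrow> (real ^ 3) set) \<Rightarrow>
   real ^ 3 \<Rightarrow> (real ^ 3) set \<Rightarrow> (real ^ 3 \<Rightarrow> real ^ 3) \<Rightarrow> bool" where
  "null_section M f D p U \<eta> \<longleftrightarrow> corank_one M f D p \<and> open U \<and> p \<in> U \<and> U \<subseteq> M \<and>
     smooth_on \<eta> U \<and> (\<forall>q\<in>U. \<eta> q \<in> D q) \<and>
     (\<forall>q\<in>singular_set M f D \<inter> U. span {\<eta> q} = hom_ker f D q)"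

text \<open>The following notions take the frame and the null section near \<open>p\<close> entering their
  definition as parameters; they are only meaningful for such a frame and null section.\<close>

definition fold_like ::
  "(real ^ 3) set \<Rightarrow> (real ^ 3 \<Rightarrow> real ^ 2) \<Rightarrow> (real ^ 3 \<Rightarrow> (real ^ 3) set) \<Rightarrow>
   (real ^ 3 \<Rightarrow> real ^ 3) \<Rightarrow> (real ^ 3 \<Rightarrow> real ^ 3) \<Rightarrow> (real ^ 3 \<Rightarrow> real ^ 3) \<Rightarrow> real ^ 3 \<Rightarrow> bool" where
  "fold_like M f D e1 e2 \<eta> p \<longleftrightarrow>
     corank_one M f D p \<and> dir_deriv \<eta> (lambda_hom f e1 e2) p \<noteq> 0"

definition cusp_like ::
  "(real ^ 3) set \<Rightarrow> (real ^ 3 \<Rightarrow> real ^ 2) \<Rightarrow> (real ^ 3 \<Rightarrow> (real ^ 3) set) \<Rightarrow>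
   (real ^ 3 \<Rightarrow> real ^ 3) \<Rightarrow> (real ^ 3 \<Rightarrow> real ^ 3) \<Rightarrow> (real ^ 3 \<Rightarrow> real ^ 3) \<Rightarrow> real ^ 3 \<Rightarrow> bool" where
  "cusp_like M f D e1 e2 \<eta> p \<longleftrightarrow>
     non_degenerate M f D e1 e2 p \<and>
     dir_deriv \<eta> (lambda_hom f e1 e2) p = 0 \<and>
     (dir_deriv \<eta> ^^ 2) (lambda_hom f e1 e2) p \<noteq> 0"

definition swallowtail_like ::
  "(real ^ 3) set \<Rightarrow> (real ^ 3 \<Rightarrow> real ^ 2) \<Rightarrow> (real ^ 3 \<Rightarrow> (real ^ 3) set) \<Rightarrow>
   (real ^ 3 \<Rightarrow> real ^ 3) \<Rightarrow> (real ^ 3 \<Rightarrow> real ^ 3) \<Rightarrow> (real ^ 3 \<Rightarrow> real ^ 3) \<Rightarrow> real ^ 3 \<Rightarrow> bool" where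
  "swallowtail_like M f D e1 e2 \<eta> p \<longleftrightarrow>
     non_degenerate M f D e1 e2 p \<and>
     dir_deriv \<eta> (lambda_hom f e1 e2) p = 0 \<and>
     (dir_deriv \<eta> ^^ 2) (lambda_hom f e1 e2) p = 0 \<and>
     rank (jacobian (\<lambda>q. vector [lambda_hom f e1 e2 q,
                                 dir_deriv \<eta> (lambda_hom f e1 e2) q,
                                 (dir_deriv \<eta> ^^ 2) (lambda_hom f e1 e2) q] :: real ^ 3) (at p)) = 3"

end

theory Submission
  imports Defs
begin

text \<open>
  Write \<open>h = \<eta>f\<close>, \<open>E = e\<^sub>1f\<close> and \<open>\<eta> = a e\<^sub>1 + b e\<^sub>2\<close>, so that \<open>det(E, h) = b \<lambda>\<close> with \<open>b(p) \<noteq> 0\<close>.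
  Applying \<open>\<eta>\<close> repeatedly to this identity expresses \<open>det(E, \<eta>\<^sup>kh)\<close> as \<open>b \<eta>\<^sup>k\<lambda>\<close> plus terms that contain
  lower derivatives of \<open>\<lambda>\<close> or of \<open>h\<close>. To see that these vanish at \<open>p\<close>, together with the relevant parts
  of their differentials, one uses that \<open>h\<close> vanishes on \<open>{\<lambda> = 0}\<close>. If \<open>d\<lambda>(p) \<noteq> 0\<close>, this gives
  \<open>\<bar>h\<bar> \<le> C\<bar>\<lambda>\<bar>\<close> near \<open>p\<close>, hence \<open>\<bar>\<eta>h\<bar> \<le> C\<bar>\<eta>\<lambda>\<bar>\<close> on the zero set and then \<open>\<bar>\<eta>h\<bar> \<le> C(\<bar>\<lambda>\<bar> + \<bar>\<eta>\<lambda>\<bar>)\<close>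
  near \<open>p\<close>. So \<open>dh(p)\<close> vanishes on \<open>ker d\<lambda>(p)\<close> and, if \<open>\<eta>\<lambda>(p) = 0\<close>, \<open>d(\<eta>h)(p)\<close> vanishes on the common
  kernel of \<open>d\<lambda>(p)\<close> and \<open>d(\<eta>\<lambda>)(p)\<close>. These estimates replace smooth division of \<open>h\<close> by \<open>\<lambda>\<close>.
\<close>

section \<open>Smooth functions\<close>

lemma Ck_on_subset: "Ck_on k g S \<Longrightarrow> T \<subseteq> S \<Longrightarrow> Ck_on k g T"
  by (induction k arbitrary: g) (auto intro: continuous_on_subset)

text \<open>Derivatives are local, so openness of \<open>S\<close> lets equality on \<open>S\<close>
  pass to the derivatives at its points.\<close>

lemma Ck_on_cong:
  assumes "open S" "\<And>x. x \<in> S \<Longrightarrow> f x = g x" "Ck_on k f S"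
  shows "Ck_on k g S"
  using assms(2,3)
proof (induction k arbitrary: f g)
  case 0
  then show ?case by (simp cong: continuous_on_cong)
next
  case (Suc k)
  have df: "f differentiable at x" if "x \<in> S" for x
    using Suc.prems that by simp
  have "g differentiable at x" if "x \<in> S" for x
    using df[OF that] has_derivative_transform_within_open[OF _ \<open>open S\<close> that] Suc.prems(1)
    unfolding differentiable_def by metis
  moreover have "Ck_on k (\<lambda>x. frechet_derivative g (at x) v) S" for v
  proof (rule Suc.IH)
    show "Ck_on k (\<lambda>x. frechet_derivative f (at x) v) S"
      using Suc.prems by simp
    show "frechet_derivative f (at x) v = frechet_derivative g (at x) v" if "x \<in> S" for x
      using frechet_derivative_transform_within_open[OF df[OF that] \<open>open S\<close> that] Suc.prems(1)
      by simp
  qed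
  ultimately show ?case by simp
qed

lemma Ck_on_Suc_imp: "Ck_on (Suc k) g S \<Longrightarrow> Ck_on k g S"
proof (induction k arbitrary: g)
  case 0
  then show ?case
    by (auto intro!: continuous_at_imp_continuous_on differentiable_imp_continuous_within)
next
  case (Suc k)
  then show ?case using Ck_on.simps(2) by blast
qed

lemma Ck_on_const: "Ck_on k (\<lambda>x. c) S"
  by (induction k arbitrary: c) auto

text \<open>Lets an explicitly computed derivative stand in for \<open>frechet_derivative\<close>,
  which is defined by a choice.\<close>

lemma Ck_on_SucI:
  assumes "open S" "\<And>x. x \<in> S \<Longrightarrow> (g has_derivative g' x) (at x)"
    "\<And>v. Ck_on k (\<lambda>x. g' x v) S"
  shows "Ck_on (Suc k) g S"
proof -
  have "Ck_on k (\<lambda>x. frechet_derivative g (at x) v) S" for v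
    using frechet_derivative_at[OF assms(2)] by (intro Ck_on_cong[OF \<open>open S\<close> _ assms(3)]) simp
  then show ?thesis
    using assms(2) by (auto simp: differentiable_def)
qed

lemma Ck_on_Suc_has_derivative:
  "Ck_on (Suc k) g S \<Longrightarrow> x \<in> S \<Longrightarrow> (g has_derivative frechet_derivative g (at x)) (at x)"
  by (simp flip: frechet_derivative_works)

lemma Ck_on_add:
  assumes "open S" "Ck_on k f S" "Ck_on k g S"
  shows "Ck_on k (\<lambda>x. f x + g x) S"
  using assms(2,3)
proof (induction k arbitrary: f g)
  case 0
  then show ?case by (auto intro: continuous_on_add)
next
  case (Suc k)
  show ?case
  proof (rule Ck_on_SucI[OF \<open>open S\<close>])
    show "((\<lambda>x. f x + g x) has_derivative
        (\<lambda>v. frechet_derivative f (at x) v + frechet_derivative g (at x) v)) (at x)"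
      if "x \<in> S" for x
      using that Suc.prems by (intro has_derivative_add Ck_on_Suc_has_derivative)
    show "Ck_on k (\<lambda>x. frechet_derivative f (at x) v + frechet_derivative g (at x) v) S" for v
      using Suc.prems by (intro Suc.IH) auto
  qed
qed

text \<open>The product rule writes the derivative as a sum of two products with factors of class
  \<open>k\<close>, so the induction closes. One proof serves scaling, inner products, real products
  and \<open>det_cols\<close>.\<close>

lemma (in bounded_bilinear) Ck_on:
  assumes "open S" "Ck_on k f S" "Ck_on k g S"
  shows "Ck_on k (\<lambda>x. prod (f x) (g x)) S"
  using assms(2,3)
proof (induction k arbitrary: f g)
  case 0
  then show ?case by (auto intro: continuous_on)
next
  case (Suc k)
  show ?case
  proof (rule Ck_on_SucI[OF \<open>open S\<close>])
    show "((\<lambda>x. prod (f x) (g x)) has_derivative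
        (\<lambda>v. prod (f x) (frechet_derivative g (at x) v) + prod (frechet_derivative f (at x) v) (g x))) (at x)"
      if "x \<in> S" for x
      using that Suc.prems by (intro FDERIV Ck_on_Suc_has_derivative)
    show "Ck_on k (\<lambda>x. prod (f x) (frechet_derivative g (at x) v)
        + prod (frechet_derivative f (at x) v) (g x)) S" for v
      using Suc.prems Ck_on_Suc_imp[OF Suc.prems(1)] Ck_on_Suc_imp[OF Suc.prems(2)]
      by (intro Ck_on_add[OF \<open>open S\<close>] Suc.IH) auto
  qed
qed

lemma Ck_on_inverse:
  fixes f :: "'a::euclidean_space \<Rightarrow> real"
  assumes "open S" "Ck_on k f S" "\<And>x. x \<in> S \<Longrightarrow> f x \<noteq> 0"
  shows "Ck_on k (\<lambda>x. inverse (f x)) S"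
  using assms(2)
proof (induction k)
  case 0
  then show ?case using assms(3) by (auto intro: continuous_on_inverse)
next
  case (Suc k)
  \<comment> \<open>The inverse recurs in its own derivative, but there only class \<open>k\<close>
    is required of it. The factor \<open>- 1\<close> below turns negation into a product.\<close>
  note IH = Suc.IH[OF Ck_on_Suc_imp[OF Suc.prems]]
  show ?case
  proof (rule Ck_on_SucI[OF \<open>open S\<close>])
    show "((\<lambda>x. inverse (f x)) has_derivative
        (\<lambda>v. - 1 * (inverse (f x) * frechet_derivative f (at x) v * inverse (f x)))) (at x)"
      if "x \<in> S" for x
      using Deriv.has_derivative_inverse[OF assms(3)[OF that] Ck_on_Suc_has_derivative[OF Suc.prems that]]
      by simp
    show "Ck_on k (\<lambda>x. - 1 * (inverse (f x) * frechet_derivative f (at x) v * inverse (f x))) S" for v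
      using Suc.prems IH
      by (intro bounded_bilinear.Ck_on[OF bounded_bilinear_mult] \<open>open S\<close> Ck_on_const) auto
  qed
qed

lemma Ck_on_sum:
  assumes "open S" "finite A" "\<And>i. i \<in> A \<Longrightarrow> Ck_on k (f i) S"
  shows "Ck_on k (\<lambda>x. \<Sum>i\<in>A. f i x) S"
  using assms(2,3)
  by (induction A) (auto intro: Ck_on_const Ck_on_add[OF \<open>open S\<close>])

lemma frechet_derivative_basis_sum:
  assumes "g differentiable at q"
  shows "frechet_derivative g (at q) w = (\<Sum>i\<in>Basis. (w \<bullet> i) *\<^sub>R frechet_derivative g (at q) i)"
proof -
  interpret linear "frechet_derivative g (at q)"
    using assms by (rule linear_frechet_derivative)
  have "frechet_derivative g (at q) w = frechet_derivative g (at q) (\<Sum>i\<in>Basis. (w \<bullet> i) *\<^sub>R i)"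
    by (simp add: euclidean_representation)
  then show ?thesis by (simp add: sum scale)
qed

text \<open>\<open>Ck_on\<close> controls derivatives in constant directions only. Expanding
  \<open>\<xi>\<close> in the standard basis reduces the varying direction to a finite sum of
  products.\<close>

lemma Ck_on_dir_deriv:
  assumes "open S" "Ck_on (Suc k) g S" "Ck_on k \<xi> S"
  shows "Ck_on k (dir_deriv \<xi> g) S"
proof (rule Ck_on_cong[OF \<open>open S\<close>])
  show "(\<Sum>i\<in>Basis. (\<xi> x \<bullet> i) *\<^sub>R frechet_derivative g (at x) i) = dir_deriv \<xi> g x" if "x \<in> S" for x
    using assms(2) that by (simp add: dir_deriv_def frechet_derivative_basis_sum[of g x "\<xi> x"])
  show "Ck_on k (\<lambda>x. \<Sum>i\<in>Basis. (\<xi> x \<bullet> i) *\<^sub>R frechet_derivative g (at x) i) S"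
    using assms(2,3)
    by (intro Ck_on_sum[OF \<open>open S\<close> finite_Basis] Ck_on_const \<open>open S\<close>
        bounded_bilinear.Ck_on[OF bounded_bilinear_scaleR \<open>open S\<close>]
        bounded_bilinear.Ck_on[OF bounded_bilinear_inner \<open>open S\<close>]) simp_all
qed

lemma smooth_on_subset: "smooth_on g S \<Longrightarrow> T \<subseteq> S \<Longrightarrow> smooth_on g T"
  unfolding smooth_on_def using Ck_on_subset by blast

lemma smooth_on_has_derivative:
  "smooth_on g S \<Longrightarrow> x \<in> S \<Longrightarrow> (g has_derivative frechet_derivative g (at x)) (at x)"
  unfolding smooth_on_def using Ck_on_Suc_has_derivative by blast

lemma smooth_on_differentiable: "smooth_on g S \<Longrightarrow> x \<in> S \<Longrightarrow> g differentiable at x"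
  using smooth_on_has_derivative differentiableI by blast

lemma smooth_on_isCont: "smooth_on g S \<Longrightarrow> x \<in> S \<Longrightarrow> isCont g x"
  using smooth_on_differentiable differentiable_imp_continuous_within by blast

lemma smooth_on_frechet_derivative:
  "smooth_on g S \<Longrightarrow> smooth_on (\<lambda>x. frechet_derivative g (at x) v) S"
  unfolding smooth_on_def using Ck_on.simps(2) by blast

lemma smooth_on_dir_deriv:
  "open S \<Longrightarrow> smooth_on g S \<Longrightarrow> smooth_on \<xi> S \<Longrightarrow> smooth_on (dir_deriv \<xi> g) S"
  unfolding smooth_on_def using Ck_on_dir_deriv by blast

lemma (in bounded_bilinear) smooth_on:
  "open S \<Longrightarrow> smooth_on f S \<Longrightarrow> smooth_on g S \<Longrightarrow> smooth_on (\<lambda>x. prod (f x) (g x)) S"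
  unfolding smooth_on_def using Ck_on by blast

lemma smooth_on_const: "smooth_on (\<lambda>x. c) S"
  unfolding smooth_on_def using Ck_on_const by blast

lemma smooth_on_add:
  "open S \<Longrightarrow> smooth_on f S \<Longrightarrow> smooth_on g S \<Longrightarrow> smooth_on (\<lambda>x. f x + g x) S"
  unfolding smooth_on_def using Ck_on_add by blast

lemma smooth_on_diff:
  assumes "open S" "smooth_on f S" "smooth_on g S"
  shows "smooth_on (\<lambda>x. f x - g x) S"
proof -
  have "smooth_on (\<lambda>x. f x + (- 1) *\<^sub>R g x) S"
    by (intro smooth_on_add bounded_bilinear.smooth_on[OF bounded_bilinear_scaleR] smooth_on_const assms)
  then show ?thesis by simp
qed

lemma smooth_on_divide:
  fixes f g :: "'a::euclidean_space \<Rightarrow> real"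
  assumes "open S" "smooth_on f S" "smooth_on g S" "\<And>x. x \<in> S \<Longrightarrow> g x \<noteq> 0"
  shows "smooth_on (\<lambda>x. f x / g x) S"
proof -
  have "smooth_on (\<lambda>x. inverse (g x)) S"
    using assms Ck_on_inverse unfolding smooth_on_def by blast
  then show ?thesis
    unfolding divide_inverse using assms bounded_bilinear.smooth_on[OF bounded_bilinear_mult] by blast
qed

lemma dir_deriv_cong:
  assumes "open S" "q \<in> S" "\<And>x. x \<in> S \<Longrightarrow> f x = g x" "f differentiable at q"
  shows "dir_deriv \<xi> f q = dir_deriv \<xi> g q"
  unfolding dir_deriv_def using frechet_derivative_transform_within_open[OF assms(4,1,2)] assms(3) by simp

lemma (in bounded_bilinear) frechet_derivative_bilinear:
  assumes "f differentiable at q" "g differentiable at q"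
  shows "frechet_derivative (\<lambda>x. prod (f x) (g x)) (at q) v
    = prod (frechet_derivative f (at q) v) (g q) + prod (f q) (frechet_derivative g (at q) v)"
  using fun_cong[OF frechet_derivative_at[OF FDERIV[OF assms[unfolded frechet_derivative_works]]], of v]
  by (simp add: add.commute)

lemma det_cols_eq: "det_cols a b = a $ 1 * b $ 2 - a $ 2 * b $ 1"
  by (simp add: det_cols_def det_2 transpose_def)

text \<open>Makes the general product rules available for the determinant. The factor 2 counts the
  two products in its expansion.\<close>

lemma bounded_bilinear_det_cols: "bounded_bilinear det_cols"
proof (intro bounded_bilinear.intro exI allI)
  show "norm (det_cols a b) \<le> norm a * norm b * 2" for a b
  proof -
    have "\<bar>a $ i * b $ j\<bar> \<le> norm a * norm b" for i j
      unfolding abs_mult by (intro mult_mono component_le_norm_cart) auto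
    from this[of 1 2] this[of 2 1] show ?thesis
      unfolding det_cols_eq by auto
  qed
qed (auto simp: det_cols_eq algebra_simps)

section \<open>Functions vanishing on a regular zero set\<close>

text \<open>The operator norm of the derivative is at most the sum \<open>N\<close> of the norms of
  the partial derivatives. \<open>N\<close> is continuous, hence below \<open>N p + 1\<close> on a
  ball, and the mean value inequality applies there by convexity.\<close>

lemma smooth_on_locally_lipschitz:
  fixes g :: "'a::euclidean_space \<Rightarrow> 'b::real_normed_vector"
  assumes "open S" "smooth_on g S" "p \<in> S"
  obtains L \<epsilon> where "\<epsilon> > 0" "L \<ge> 0" "ball p \<epsilon> \<subseteq> S"
    "\<And>x y. x \<in> ball p \<epsilon> \<Longrightarrow> y \<in> ball p \<epsilon> \<Longrightarrow> norm (g x - g y) \<le> L * norm (x - y)"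
proof -
  define N where "N x = (\<Sum>i\<in>Basis. norm (frechet_derivative g (at x) i))" for x
  have "isCont N p"
    unfolding N_def[abs_def]
    by (intro continuous_sum continuous_norm smooth_on_isCont[where S = S, OF smooth_on_frechet_derivative] assms)
  then have "\<forall>\<^sub>F x in nhds p. N x < N p + 1"
    by (intro order_tendstoD(2)[of N "N p"]) (simp_all add: isCont_def tendsto_nhds_iff)
  moreover have "\<forall>\<^sub>F x in nhds p. x \<in> S"
    using assms eventually_nhds by blast
  ultimately have "\<forall>\<^sub>F x in nhds p. x \<in> S \<and> N x < N p + 1"
    by eventually_elim simp
  then obtain \<epsilon> where \<epsilon>: "\<epsilon> > 0" "\<And>x. x \<in> ball p \<epsilon> \<Longrightarrow> x \<in> S \<and> N x < N p + 1"
    by (auto simp: eventually_nhds_metric dist_commute)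
  have bound: "onorm (frechet_derivative g (at x)) \<le> N p + 1" if "x \<in> ball p \<epsilon>" for x
  proof (rule onorm_le)
    fix v
    have "norm (frechet_derivative g (at x) v)
        \<le> (\<Sum>i\<in>Basis. norm ((v \<bullet> i) *\<^sub>R frechet_derivative g (at x) i))"
      unfolding frechet_derivative_basis_sum[OF smooth_on_differentiable[OF assms(2)], of x v,
          OF conjunct1[OF \<epsilon>(2)[OF that]]]
      by (rule norm_sum)
    also have "\<dots> \<le> (\<Sum>i\<in>Basis. norm v * norm (frechet_derivative g (at x) i))"
      by (intro sum_mono) (simp add: mult_right_mono Basis_le_norm)
    also have "\<dots> = N x * norm v"
      by (simp add: N_def sum_distrib_left mult.commute)
    also have "\<dots> \<le> (N p + 1) * norm v"
      using \<epsilon>(2)[OF that] by (intro mult_right_mono) auto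
    finally show "norm (frechet_derivative g (at x) v) \<le> (N p + 1) * norm v" .
  qed
  have "0 \<le> N p"
    unfolding N_def by (intro sum_nonneg) simp
  moreover have "norm (g x - g y) \<le> (N p + 1) * norm (x - y)"
    if "x \<in> ball p \<epsilon>" "y \<in> ball p \<epsilon>" for x y
    using that \<epsilon>(2) bound smooth_on_has_derivative[OF assms(2)]
    by (intro differentiable_bound[of "ball p \<epsilon>" _ "\<lambda>x. frechet_derivative g (at x)"])
      (auto intro: has_derivative_at_withinI)
  ultimately show thesis
    using \<epsilon> by (intro that[of \<epsilon> "N p + 1"]) auto
qed

text \<open>Moving along a direction in which \<open>\<Lambda>\<close> increases at a definite rate, one meets the zero set
  of \<open>\<Lambda>\<close> within a distance proportional to \<open>\<bar>\<Lambda>\<bar>\<close>; this replaces the implicit function theorem.\<close>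

lemma zero_set_distance_bound:
  fixes \<Lambda> :: "'a::euclidean_space \<Rightarrow> real"
  assumes "open S" "smooth_on \<Lambda> S" "p \<in> S" "\<Lambda> p = 0"
    and nz: "frechet_derivative \<Lambda> (at p) \<noteq> (\<lambda>v. 0)" and "\<epsilon> > 0"
  obtains K where "K \<ge> 0"
    "\<forall>\<^sub>F q in nhds p. \<exists>q'\<in>ball p \<epsilon> \<inter> S. \<Lambda> q' = 0 \<and> norm (q - q') \<le> K * \<bar>\<Lambda> q\<bar>"
proof -
  note lin = linear_frechet_derivative[OF smooth_on_differentiable[OF assms(2,3)]]
  obtain w where w: "frechet_derivative \<Lambda> (at p) w \<noteq> 0"
    using nz by auto
  \<comment> \<open>Normalised so that \<Lambda> grows at rate 1 along \<open>v\<close> at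
    \<open>p\<close>, hence at rate above 1/2 nearby.\<close>
  define v where "v = w /\<^sub>R frechet_derivative \<Lambda> (at p) w"
  have v: "frechet_derivative \<Lambda> (at p) v = 1"
    using w by (simp add: v_def linear_scale[OF lin])
  define d where "d x = frechet_derivative \<Lambda> (at x) v" for x
  have "isCont d p"
    unfolding d_def[abs_def]
    by (intro smooth_on_isCont[where S = S, OF smooth_on_frechet_derivative] assms)
  then have "\<forall>\<^sub>F x in nhds p. 1/2 < d x"
    using v by (intro order_tendstoD(1)[of _ "d p"]) (simp_all add: isCont_def tendsto_nhds_iff, simp add: d_def)
  moreover have "\<forall>\<^sub>F x in nhds p. x \<in> S"
    using assms eventually_nhds by blast
  moreover have "\<forall>\<^sub>F x in nhds p. x \<in> ball p \<epsilon>"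
    using \<open>\<epsilon> > 0\<close> by (intro eventually_nhds_in_open) auto
  ultimately have "\<forall>\<^sub>F x in nhds p. x \<in> ball p \<epsilon> \<inter> S \<and> 1/2 < d x"
    by eventually_elim simp
  then obtain r where r: "r > 0" "\<And>x. x \<in> ball p r \<Longrightarrow> x \<in> ball p \<epsilon> \<inter> S \<and> 1/2 < d x"
    by (auto simp: eventually_nhds_metric dist_commute)
  have "isCont \<Lambda> p" using assms(2,3) by (rule smooth_on_isCont)
  \<comment> \<open>This sum bounds the distance from \<open>p\<close> to any point of the segment
    \<open>c\<close> used below, so for \<open>q\<close> close to \<open>p\<close> the whole segment
    stays where the rate exceeds 1/2.\<close>
  then have "((\<lambda>q. norm (q - p) + 2 * \<bar>\<Lambda> q\<bar> * norm v) \<longlongrightarrow> norm (p - p) + 2 * \<bar>0\<bar> * norm v) (nhds p)"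
    using \<open>\<Lambda> p = 0\<close> by (intro tendsto_intros) (auto simp: isCont_def tendsto_nhds_iff)
  then have "\<forall>\<^sub>F q in nhds p. norm (q - p) + 2 * \<bar>\<Lambda> q\<bar> * norm v < r"
    using r by (intro order_tendstoD(2)) auto
  then have "\<forall>\<^sub>F q in nhds p. \<exists>q'\<in>ball p \<epsilon> \<inter> S. \<Lambda> q' = 0 \<and> norm (q - q') \<le> 2 * norm v * \<bar>\<Lambda> q\<bar>"
  proof eventually_elim
    case (elim q)
    \<comment> \<open>At rate at least 1/2, parameter length
      \<open>2 * \<bar>\<Lambda> q\<bar>\<close> changes \<Lambda> by at least
      \<open>\<bar>\<Lambda> q\<bar>\<close>. This suffices to reach both signs at the two ends, and
      the intermediate value theorem gives a zero.\<close>
    define s where "s = 2 * \<bar>\<Lambda> q\<bar>"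
    define c where "c t = q + t *\<^sub>R v" for t
    have c_ball: "c t \<in> ball p r" if "\<bar>t\<bar> \<le> s" for t
    proof -
      have "norm (c t - p) \<le> norm (q - p) + \<bar>t\<bar> * norm v"
        unfolding c_def by (metis add_diff_eq add.commute norm_scaleR norm_triangle_ineq)
      also have "\<dots> \<le> norm (q - p) + s * norm v"
        using that by (intro add_left_mono mult_right_mono) auto
      also have "\<dots> < r" using elim by (simp add: s_def)
      finally show ?thesis by (simp add: dist_norm norm_minus_commute)
    qed
    have der: "((\<lambda>t. \<Lambda> (c t)) has_real_derivative d (c t)) (at t)" if "\<bar>t\<bar> \<le> s" for t
    proof -
      have "c t \<in> S" using r c_ball[OF that] by blast
      have "(c has_derivative (\<lambda>t. t *\<^sub>R v)) (at t)"
        unfolding c_def by (auto intro!: derivative_eq_intros)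
      from has_derivative_compose[OF this smooth_on_has_derivative[OF assms(2) \<open>c t \<in> S\<close>]]
      show ?thesis
        unfolding has_field_derivative_def d_def
        by (simp add: linear_scale[OF linear_frechet_derivative[OF
                smooth_on_differentiable[OF assms(2) \<open>c t \<in> S\<close>]]] mult_commute_abs)
    qed
    have mono: "\<Lambda> (c b) - \<Lambda> (c a) \<ge> (b - a) / 2" if ab: "- s \<le> a" "a \<le> b" "b \<le> s" for a b
    proof (cases "a = b")
      case False
      then have "a < b" using ab by simp
      then obtain z where z: "a < z" "z < b" "\<Lambda> (c b) - \<Lambda> (c a) = (b - a) * d (c z)"
        using MVT2[of a b "\<lambda>t. \<Lambda> (c t)" "\<lambda>t. d (c t)"] der ab by fastforce
      have "\<bar>z\<bar> \<le> s" using z ab by linarith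
      then have "d (c z) \<ge> 1/2" using r(2)[OF c_ball] by fastforce
      then have "(b - a) * (1/2) \<le> (b - a) * d (c z)"
        using \<open>a < b\<close> by (intro mult_left_mono) auto
      then show ?thesis using z by simp
    qed simp
    have "0 \<le> s" by (simp add: s_def)
    have "c 0 = q" by (simp add: c_def)
    then have "\<Lambda> (c s) \<ge> \<Lambda> q + \<bar>\<Lambda> q\<bar>" "\<Lambda> (c (- s)) \<le> \<Lambda> q - \<bar>\<Lambda> q\<bar>"
      using mono[of 0 s] mono[of "- s" 0] \<open>0 \<le> s\<close> by (auto simp: s_def)
    then have "\<Lambda> (c (- s)) \<le> 0" "0 \<le> \<Lambda> (c s)" by auto
    moreover have "\<forall>t. - s \<le> t \<and> t \<le> s \<longrightarrow> isCont (\<lambda>t. \<Lambda> (c t)) t"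
      using der DERIV_isCont by (meson abs_le_iff minus_le_iff)
    ultimately obtain t where t: "- s \<le> t" "t \<le> s" "\<Lambda> (c t) = 0"
      using IVT[of "\<lambda>t. \<Lambda> (c t)" "- s" 0 s] \<open>0 \<le> s\<close> by auto
    have "norm (q - c t) = \<bar>t\<bar> * norm v" by (simp add: c_def)
    also have "\<dots> \<le> s * norm v" using t by (intro mult_right_mono) auto
    finally show ?case
      using t r(2)[OF c_ball[of t]] by (intro bexI[of _ "c t"]) (auto simp: s_def mult_ac)
  qed
  then show thesis by (intro that[of "2 * norm v"]) auto
qed

text \<open>Each \<open>q\<close> near \<open>p\<close> has a zero \<open>q'\<close> of \<Lambda> at
  distance O(\<open>\<bar>\<Lambda> q\<bar>\<close>). Between \<open>q\<close> and \<open>q'\<close>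
  both \<open>u\<close> and \<mu> change by at most a Lipschitz constant times that
  distance.\<close>

lemma norm_le_on_zero_set_imp_norm_le:
  fixes \<Lambda> \<mu> :: "'a::euclidean_space \<Rightarrow> real" and u :: "'a \<Rightarrow> 'b::real_normed_vector"
  assumes "open S" "smooth_on \<Lambda> S" "p \<in> S" "\<Lambda> p = 0"
    and "frechet_derivative \<Lambda> (at p) \<noteq> (\<lambda>v. 0)"
    and "smooth_on \<mu> S" "smooth_on u S" "C \<ge> 0"
    and le: "\<forall>\<^sub>F q in nhds p. \<Lambda> q = 0 \<longrightarrow> norm (u q) \<le> C * \<bar>\<mu> q\<bar>"
  obtains C' where "C' \<ge> 0" "\<forall>\<^sub>F q in nhds p. norm (u q) \<le> C' * (\<bar>\<Lambda> q\<bar> + \<bar>\<mu> q\<bar>)"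
proof -
  obtain L1 \<epsilon>1 where 1: "\<epsilon>1 > 0" "L1 \<ge> 0" "ball p \<epsilon>1 \<subseteq> S"
    "\<And>x y. x \<in> ball p \<epsilon>1 \<Longrightarrow> y \<in> ball p \<epsilon>1 \<Longrightarrow> norm (u x - u y) \<le> L1 * norm (x - y)"
    using smooth_on_locally_lipschitz[OF assms(1,7,3)] by metis
  obtain L2 \<epsilon>2 where 2: "\<epsilon>2 > 0" "L2 \<ge> 0" "ball p \<epsilon>2 \<subseteq> S"
    "\<And>x y. x \<in> ball p \<epsilon>2 \<Longrightarrow> y \<in> ball p \<epsilon>2 \<Longrightarrow> norm (\<mu> x - \<mu> y) \<le> L2 * norm (x - y)"
    using smooth_on_locally_lipschitz[OF assms(1,6,3)] by metis
  obtain \<epsilon>3 where 3: "\<epsilon>3 > 0" "\<And>q. q \<in> ball p \<epsilon>3 \<Longrightarrow> \<Lambda> q = 0 \<Longrightarrow> norm (u q) \<le> C * \<bar>\<mu> q\<bar>"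
    using le by (auto simp: eventually_nhds_metric dist_commute)
  define \<epsilon> where "\<epsilon> = min \<epsilon>1 (min \<epsilon>2 \<epsilon>3)"
  have "\<epsilon> > 0" using 1 2 3 by (simp add: \<epsilon>_def)
  obtain K where K: "K \<ge> 0"
    "\<forall>\<^sub>F q in nhds p. \<exists>q'\<in>ball p \<epsilon> \<inter> S. \<Lambda> q' = 0 \<and> norm (q - q') \<le> K * \<bar>\<Lambda> q\<bar>"
    by (rule zero_set_distance_bound[OF assms(1-5) \<open>\<epsilon> > 0\<close>])
  \<comment> \<open>\<open>L1\<close> and \<open>C * L2\<close> pay for moving \<open>u\<close> and
    \<mu> between \<open>q\<close> and \<open>q'\<close>, and \<open>K\<close> converts that
    distance into \<Lambda>. The last \<open>C\<close> is the constant on the zero set.\<close>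
  define C' where "C' = (L1 + C * L2) * K + C"
  have "\<forall>\<^sub>F q in nhds p. q \<in> ball p \<epsilon>"
    using \<open>\<epsilon> > 0\<close> by (intro eventually_nhds_in_open) auto
  with K(2) have "\<forall>\<^sub>F q in nhds p. norm (u q) \<le> C' * (\<bar>\<Lambda> q\<bar> + \<bar>\<mu> q\<bar>)"
  proof eventually_elim
    case (elim q)
    then obtain q' where q': "q' \<in> ball p \<epsilon>" "\<Lambda> q' = 0" "norm (q - q') \<le> K * \<bar>\<Lambda> q\<bar>"
      by auto
    have "norm (u q') \<le> C * \<bar>\<mu> q'\<bar>" using 3 q' by (simp add: \<epsilon>_def)
    also have "\<dots> \<le> C * (\<bar>\<mu> q\<bar> + L2 * norm (q - q'))"
      using 2(4)[of q q'] q' elim \<open>C \<ge> 0\<close> by (intro mult_left_mono) (auto simp: \<epsilon>_def)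
    finally have "norm (u q) \<le> C * (\<bar>\<mu> q\<bar> + L2 * norm (q - q')) + L1 * norm (q - q')"
      using 1(4)[of q q'] q' elim norm_triangle_sub[of "u q" "u q'"] by (simp add: \<epsilon>_def)
    also have "\<dots> = (L1 + C * L2) * norm (q - q') + C * \<bar>\<mu> q\<bar>"
      by (simp add: algebra_simps)
    also have "\<dots> \<le> (L1 + C * L2) * (K * \<bar>\<Lambda> q\<bar>) + C * \<bar>\<mu> q\<bar>"
      using 1 2 q' \<open>C \<ge> 0\<close> by (intro add_right_mono mult_left_mono) auto
    also have "\<dots> \<le> C' * (\<bar>\<Lambda> q\<bar> + \<bar>\<mu> q\<bar>)"
      using 1 2 K \<open>C \<ge> 0\<close> by (simp add: C'_def algebra_simps)
    finally show ?case .
  qed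
  moreover have "C' \<ge> 0" using 1 2 K \<open>C \<ge> 0\<close> by (simp add: C'_def)
  ultimately show thesis using that by blast
qed

text \<open>The bound forces \<open>u q = 0\<close>, so it can be divided by
  \<open>\<bar>t\<bar>\<close> along the line through \<open>q\<close> in direction
  \<open>v\<close>. The difference quotients then converge to the derivatives.\<close>

lemma norm_frechet_derivative_le:
  fixes u :: "'a::euclidean_space \<Rightarrow> 'b::real_normed_vector" and w1 w2 :: "'a \<Rightarrow> real"
  assumes "u differentiable at q" "w1 differentiable at q" "w2 differentiable at q"
    and "w1 q = 0" "w2 q = 0"
    and le: "\<forall>\<^sub>F x in nhds q. norm (u x) \<le> C * (\<bar>w1 x\<bar> + \<bar>w2 x\<bar>)"
  shows "norm (frechet_derivative u (at q) v)
    \<le> C * (\<bar>frechet_derivative w1 (at q) v\<bar> + \<bar>frechet_derivative w2 (at q) v\<bar>)"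
proof -
  define c where "c t = q + t *\<^sub>R v" for t :: real
  have quot: "((\<lambda>t. (g (c t) - g q) /\<^sub>R t) \<longlongrightarrow> frechet_derivative g (at q) v) (at 0)"
    if "g differentiable at q" for g :: "'a \<Rightarrow> 'c::real_normed_vector"
  proof -
    have "(c has_derivative (\<lambda>t. t *\<^sub>R v)) (at 0)"
      unfolding c_def by (auto intro!: derivative_eq_intros)
    moreover have "(g has_derivative frechet_derivative g (at q)) (at (c 0))"
      using that by (simp add: c_def frechet_derivative_works)
    ultimately have "((\<lambda>t. g (c t)) has_derivative (\<lambda>t. frechet_derivative g (at q) (t *\<^sub>R v))) (at 0)"
      by (rule has_derivative_compose)
    then have "(\<lambda>t. norm (g (c t) - g q - t *\<^sub>R frechet_derivative g (at q) v) / norm t) \<midarrow>0\<rightarrow> 0"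
      by (simp add: has_derivative_at c_def linear_scale[OF linear_frechet_derivative[OF that]])
    moreover have "\<forall>\<^sub>F t in at 0. norm (g (c t) - g q - t *\<^sub>R frechet_derivative g (at q) v) / norm t
        = norm ((g (c t) - g q) /\<^sub>R t - frechet_derivative g (at q) v)"
      using eventually_neq_at_within[of 0]
    proof eventually_elim
      case (elim t)
      then have "(g (c t) - g q) /\<^sub>R t - frechet_derivative g (at q) v
          = (g (c t) - g q - t *\<^sub>R frechet_derivative g (at q) v) /\<^sub>R t"
        by (simp add: scaleR_diff_right)
      then show ?case by (simp add: divide_inverse mult.commute)
    qed
    ultimately have "(\<lambda>t. norm ((g (c t) - g q) /\<^sub>R t - frechet_derivative g (at q) v)) \<midarrow>0\<rightarrow> 0"
      by (rule Lim_transform_eventually)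
    then show ?thesis
      by (simp add: LIM_zero_iff tendsto_norm_zero_iff)
  qed
  have "u q = 0"
    using eventually_nhds_x_imp_x[OF le] assms(4,5) by simp
  have "(c \<longlongrightarrow> c 0) (at 0)"
    unfolding c_def by (intro tendsto_intros)
  then have "filterlim c (nhds q) (at 0)" by (simp add: c_def)
  from eventually_compose_filterlim[OF le this]
  have ev: "\<forall>\<^sub>F t in at 0. norm ((u (c t) - u q) /\<^sub>R t)
      \<le> C * (\<bar>(w1 (c t) - w1 q) /\<^sub>R t\<bar> + \<bar>(w2 (c t) - w2 q) /\<^sub>R t\<bar>)"
  proof eventually_elim
    case (elim t)
    then have "inverse \<bar>t\<bar> * norm (u (c t)) \<le> inverse \<bar>t\<bar> * (C * (\<bar>w1 (c t)\<bar> + \<bar>w2 (c t)\<bar>))"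
      by (intro mult_left_mono) auto
    then show ?case
      using assms(4,5) \<open>u q = 0\<close> by (simp add: abs_mult algebra_simps)
  qed
  show ?thesis
    by (rule tendsto_le[OF _ _ _ ev]) (intro tendsto_intros quot assms trivial_limit_at | simp)+
qed

section \<open>Null directions\<close>

lemma frechet_derivative_add:
  assumes "f differentiable at q" "g differentiable at q"
  shows "frechet_derivative (\<lambda>x. f x + g x) (at q) v
    = frechet_derivative f (at q) v + frechet_derivative g (at q) v"
  using fun_cong[OF frechet_derivative_at[OF has_derivative_add[OF assms[unfolded frechet_derivative_works]]], of v]
  by simp

lemma frechet_derivative_diff:
  assumes "f differentiable at q" "g differentiable at q"
  shows "frechet_derivative (\<lambda>x. f x - g x) (at q) v
    = frechet_derivative f (at q) v - frechet_derivative g (at q) v"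
  using fun_cong[OF frechet_derivative_at[OF has_derivative_diff[OF assms[unfolded frechet_derivative_works]]], of v]
  by simp

lemmas frechet_derivative_mult = bounded_bilinear.frechet_derivative_bilinear[OF bounded_bilinear_mult]
lemmas frechet_derivative_det_cols = bounded_bilinear.frechet_derivative_bilinear[OF bounded_bilinear_det_cols]

lemma det_cols_zero [simp]: "det_cols a 0 = 0" "det_cols 0 a = 0"
  by (simp_all add: det_cols_eq)

text \<open>Isolates the calculus along \<eta> from the distribution. The determinant in
  \<open>det_h\<close> does not see the component of \<open>h\<close> parallel to \<open>E\<close>;
  \<open>h_eq_0\<close> is what controls that component.\<close>

locale null_direction =
  fixes U :: "'a::euclidean_space set" and p :: 'a
    and \<Lambda> b :: "'a \<Rightarrow> real" and \<eta> :: "'a \<Rightarrow> 'a" and E h :: "'a \<Rightarrow> real ^ 2"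
  assumes open_U: "open U" and p_in: "p \<in> U"
    and smooth_\<Lambda>: "smooth_on \<Lambda> U" and smooth_b: "smooth_on b U" and smooth_\<eta>: "smooth_on \<eta> U"
    and smooth_E: "smooth_on E U" and smooth_h: "smooth_on h U"
    and \<Lambda>_p: "\<Lambda> p = 0"
    and h_eq_0: "q \<in> U \<Longrightarrow> \<Lambda> q = 0 \<Longrightarrow> h q = 0"
    and det_h: "q \<in> U \<Longrightarrow> det_cols (E q) (h q) = b q * \<Lambda> q"
begin

abbreviation D :: "('a \<Rightarrow> 'b::real_normed_vector) \<Rightarrow> 'a \<Rightarrow> 'b" where
  "D \<equiv> dir_deriv \<eta>"

lemma smooth_D: "smooth_on g U \<Longrightarrow> smooth_on (D g) U"
  by (rule smooth_on_dir_deriv[OF open_U _ smooth_\<eta>])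

lemmas smooth_intros = smooth_D smooth_\<Lambda> smooth_b smooth_E smooth_h smooth_on_const
  smooth_on_add[OF open_U] smooth_on_diff[OF open_U]
  bounded_bilinear.smooth_on[OF bounded_bilinear_mult open_U]
  bounded_bilinear.smooth_on[OF bounded_bilinear_det_cols open_U]

lemma differentiable: "smooth_on g U \<Longrightarrow> q \<in> U \<Longrightarrow> g differentiable at q"
  by (rule smooth_on_differentiable)

lemma D_det_cols:
  assumes "smooth_on A U" "smooth_on B U" "q \<in> U"
  shows "D (\<lambda>x. det_cols (A x) (B x)) q = det_cols (D A q) (B q) + det_cols (A q) (D B q)"
  unfolding dir_deriv_def by (intro frechet_derivative_det_cols differentiable assms)

lemma D_mult:
  assumes "smooth_on A U" "smooth_on B U" "q \<in> U"
  shows "D (\<lambda>x. A x * B x) q = D A q * B q + A q * (D B q :: real)"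
  unfolding dir_deriv_def by (intro frechet_derivative_mult differentiable assms)

lemma D_add:
  assumes "smooth_on A U" "smooth_on B U" "q \<in> U"
  shows "D (\<lambda>x. A x + B x) q = D A q + D B q"
  unfolding dir_deriv_def by (intro frechet_derivative_add differentiable assms)

lemma D_diff:
  assumes "smooth_on A U" "smooth_on B U" "q \<in> U"
  shows "D (\<lambda>x. A x - B x) q = D A q - D B q"
  unfolding dir_deriv_def by (intro frechet_derivative_diff differentiable assms)

lemma D_cong:
  assumes "smooth_on A U" "q \<in> U" "\<And>x. x \<in> U \<Longrightarrow> A x = B x"
  shows "D A q = D B q"
  by (rule dir_deriv_cong[OF open_U assms(2,3)]) (auto intro: differentiable assms)

text \<open>Differentiate \<open>det_h\<close> along \<eta> and solve for the term in which the
  derivative falls on \<open>h\<close>. \<open>det_DDh\<close> repeats this once more, leaving equal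
  terms uncombined as the product rule produces them.\<close>

lemma det_Dh:
  assumes "q \<in> U"
  shows "det_cols (E q) (D h q) = D b q * \<Lambda> q + b q * D \<Lambda> q - det_cols (D E q) (h q)"
proof -
  have "D (\<lambda>x. det_cols (E x) (h x)) q = D (\<lambda>x. b x * \<Lambda> x) q"
    by (intro D_cong det_h assms smooth_intros)
  then show ?thesis
    by (simp add: D_det_cols D_mult smooth_intros assms)
qed

lemma det_DDh:
  assumes "q \<in> U"
  shows "det_cols (E q) (D (D h) q) = D (D b) q * \<Lambda> q + D b q * D \<Lambda> q
    + (D b q * D \<Lambda> q + b q * D (D \<Lambda>) q)
    - (det_cols (D (D E) q) (h q) + det_cols (D E q) (D h q)) - det_cols (D E q) (D h q)"
proof -
  have "D (\<lambda>x. det_cols (E x) (D h x)) q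
      = D (\<lambda>x. D b x * \<Lambda> x + b x * D \<Lambda> x - det_cols (D E x) (h x)) q"
    by (intro D_cong det_Dh assms smooth_intros)
  then show ?thesis
    by (simp add: D_det_cols D_mult D_add D_diff smooth_intros assms)
qed

lemma h_p: "h p = 0"
  by (rule h_eq_0[OF p_in \<Lambda>_p])

lemma det_Dh_p: "det_cols (E p) (D h p) = b p * D \<Lambda> p"
  by (simp add: det_Dh p_in \<Lambda>_p h_p)

section \<open>Estimates and differentials at a non-degenerate point\<close>

context
  assumes nondegenerate: "frechet_derivative \<Lambda> (at p) \<noteq> (\<lambda>v. 0)"
begin

text \<open>Since \<open>h\<close> vanishes on the zero set, the comparison lemma applies with
  constant 0 and with \<Lambda> itself as \<mu>, whence the doubled term.\<close>

lemma norm_h_le: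
  obtains C where "C \<ge> 0" "\<forall>\<^sub>F q in nhds p. norm (h q) \<le> C * (\<bar>\<Lambda> q\<bar> + \<bar>\<Lambda> q\<bar>)"
proof (rule norm_le_on_zero_set_imp_norm_le[OF open_U smooth_\<Lambda> p_in \<Lambda>_p nondegenerate smooth_\<Lambda> smooth_h])
  have "\<forall>\<^sub>F q in nhds p. q \<in> U"
    using open_U p_in by (rule eventually_nhds_in_open)
  then show "\<forall>\<^sub>F q in nhds p. \<Lambda> q = 0 \<longrightarrow> norm (h q) \<le> 0 * \<bar>\<Lambda> q\<bar>"
    by eventually_elim (simp add: h_eq_0)
qed (auto intro: that)

lemma norm_Dh_le:
  obtains C where "C \<ge> 0" "\<forall>\<^sub>F q in nhds p. norm (D h q) \<le> C * (\<bar>\<Lambda> q\<bar> + \<bar>D \<Lambda> q\<bar>)"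
proof -
  obtain C where C: "C \<ge> 0" "\<forall>\<^sub>F q in nhds p. norm (h q) \<le> C * (\<bar>\<Lambda> q\<bar> + \<bar>\<Lambda> q\<bar>)"
    by (rule norm_h_le)
  have "\<forall>\<^sub>F q in nhds p. q \<in> U"
    using open_U p_in by (rule eventually_nhds_in_open)
  \<comment> \<open>The bound on \<open>h\<close> is differentiated at all zeros of \<Lambda> near
    \<open>p\<close>, so it must hold around each of them. The doubled term in it yields the
    constant \<open>2 * C\<close>.\<close>
  moreover have "\<forall>\<^sub>F q in nhds p. \<forall>\<^sub>F x in nhds q. norm (h x) \<le> C * (\<bar>\<Lambda> x\<bar> + \<bar>\<Lambda> x\<bar>)"
    using C(2) by (simp add: eventually_eventually)
  ultimately have "\<forall>\<^sub>F q in nhds p. \<Lambda> q = 0 \<longrightarrow> norm (D h q) \<le> (2 * C) * \<bar>D \<Lambda> q\<bar>"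
  proof eventually_elim
    case (elim q)
    then show ?case
      using norm_frechet_derivative_le[OF differentiable[OF smooth_h] differentiable[OF smooth_\<Lambda>]
          differentiable[OF smooth_\<Lambda>], of q C "\<eta> q"]
      by (simp add: dir_deriv_def mult_ac)
  qed
  then show thesis
    using that C(1)
    by (elim norm_le_on_zero_set_imp_norm_le[OF open_U smooth_\<Lambda> p_in \<Lambda>_p nondegenerate
          smooth_D[OF smooth_\<Lambda>] smooth_D[OF smooth_h], rotated]) auto
qed

lemma frechet_derivative_h_eq_0:
  assumes "frechet_derivative \<Lambda> (at p) v = 0"
  shows "frechet_derivative h (at p) v = 0"
proof -
  obtain C where "C \<ge> 0" "\<forall>\<^sub>F q in nhds p. norm (h q) \<le> C * (\<bar>\<Lambda> q\<bar> + \<bar>\<Lambda> q\<bar>)"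
    by (rule norm_h_le)
  from norm_frechet_derivative_le[OF _ _ _ _ _ this(2), of v] assms show ?thesis
    by (simp add: differentiable[OF _ p_in] smooth_intros \<Lambda>_p)
qed

text \<open>Both functions on the right of \<open>norm_Dh_le\<close> vanish at \<open>p\<close>, so
  that bound may be differentiated there. A factorisation \<open>h = \<Lambda> k\<close> with smooth
  \<open>k\<close> would give the same conclusion by the product rule.\<close>

lemma frechet_derivative_Dh_eq_0:
  assumes "D \<Lambda> p = 0" "frechet_derivative \<Lambda> (at p) v = 0" "frechet_derivative (D \<Lambda>) (at p) v = 0"
  shows "frechet_derivative (D h) (at p) v = 0"
proof -
  obtain C where "C \<ge> 0" "\<forall>\<^sub>F q in nhds p. norm (D h q) \<le> C * (\<bar>\<Lambda> q\<bar> + \<bar>D \<Lambda> q\<bar>)"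
    by (rule norm_Dh_le)
  from norm_frechet_derivative_le[OF _ _ _ _ _ this(2), of v] assms show ?thesis
    by (simp add: differentiable[OF _ p_in] smooth_intros \<Lambda>_p)
qed

text \<open>\<open>D \<Lambda> p = 0\<close> says that \<open>\<eta> p\<close> itself lies in the
  kernel of the differential of \<Lambda>. \<open>DDh_p\<close> uses the common kernel in the same
  way.\<close>

lemma Dh_p: "D \<Lambda> p = 0 \<Longrightarrow> D h p = 0"
  using frechet_derivative_h_eq_0[of "\<eta> p"] by (simp add: dir_deriv_def)

lemma DDh_p: "D \<Lambda> p = 0 \<Longrightarrow> D (D \<Lambda>) p = 0 \<Longrightarrow> D (D h) p = 0"
  using frechet_derivative_Dh_eq_0[of "\<eta> p"] by (simp add: dir_deriv_def)

lemma det_DDh_p: "D \<Lambda> p = 0 \<Longrightarrow> det_cols (E p) (D (D h) p) = b p * D (D \<Lambda>) p"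
  by (simp add: det_DDh p_in \<Lambda>_p h_p Dh_p)

text \<open>First of three row comparisons between the Jacobians of the determinants and of the
  derivatives of \<Lambda>. Each row is \<open>b p\<close> times its counterpart on the common
  kernel of the preceding rows.\<close>

lemma frechet_derivative_det_h:
  "frechet_derivative (\<lambda>q. det_cols (E q) (h q)) (at p) v = b p * frechet_derivative \<Lambda> (at p) v"
proof -
  have "frechet_derivative (\<lambda>q. det_cols (E q) (h q)) (at p) = frechet_derivative (\<lambda>q. b q * \<Lambda> q) (at p)"
    by (intro frechet_derivative_transform_within_open[OF _ open_U p_in] det_h differentiable
        smooth_intros p_in)
  then show ?thesis
    by (simp add: frechet_derivative_mult differentiable[OF _ p_in] smooth_intros \<Lambda>_p)
qed

lemma frechet_derivative_det_Dh:
  assumes "D \<Lambda> p = 0" "frechet_derivative \<Lambda> (at p) v = 0"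
  shows "frechet_derivative (\<lambda>q. det_cols (E q) (D h q)) (at p) v
    = b p * frechet_derivative (D \<Lambda>) (at p) v"
proof -
  have "frechet_derivative (\<lambda>q. det_cols (E q) (D h q)) (at p)
      = frechet_derivative (\<lambda>q. D b q * \<Lambda> q + b q * D \<Lambda> q - det_cols (D E q) (h q)) (at p)"
    by (intro frechet_derivative_transform_within_open[OF _ open_U p_in] det_Dh differentiable
        smooth_intros p_in)
  then show ?thesis
    by (simp add: frechet_derivative_mult frechet_derivative_det_cols frechet_derivative_add
        frechet_derivative_diff differentiable[OF _ p_in] smooth_intros \<Lambda>_p h_p assms
        frechet_derivative_h_eq_0)
qed

text \<open>In every term of \<open>det_DDh\<close> except \<open>b q * D (D \<Lambda>) q\<close>,
  one of the factors \<Lambda>, \<open>D \<Lambda>\<close>, \<open>h\<close>, \<open>D h\<close>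
  vanishes at \<open>p\<close> together with its derivative in direction \<open>v\<close>.\<close>

lemma frechet_derivative_det_DDh:
  assumes "D \<Lambda> p = 0" "D (D \<Lambda>) p = 0"
    "frechet_derivative \<Lambda> (at p) v = 0" "frechet_derivative (D \<Lambda>) (at p) v = 0"
  shows "frechet_derivative (\<lambda>q. det_cols (E q) (D (D h) q)) (at p) v
    = b p * frechet_derivative (D (D \<Lambda>)) (at p) v"
proof -
  have "frechet_derivative (\<lambda>q. det_cols (E q) (D (D h) q)) (at p)
      = frechet_derivative (\<lambda>q. D (D b) q * \<Lambda> q + D b q * D \<Lambda> q
          + (D b q * D \<Lambda> q + b q * D (D \<Lambda>) q)
          - (det_cols (D (D E) q) (h q) + det_cols (D E q) (D h q)) - det_cols (D E q) (D h q)) (at p)"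
    by (intro frechet_derivative_transform_within_open[OF _ open_U p_in] det_DDh differentiable
        smooth_intros p_in)
  then show ?thesis
    by (simp add: frechet_derivative_mult frechet_derivative_det_cols frechet_derivative_add
        frechet_derivative_diff differentiable[OF _ p_in] smooth_intros \<Lambda>_p h_p Dh_p assms
        frechet_derivative_h_eq_0 frechet_derivative_Dh_eq_0)
qed

lemma det_DDDh_p:
  assumes "D \<Lambda> p = 0" "D (D \<Lambda>) p = 0"
  shows "det_cols (E p) (D (D (D h)) p) = b p * D (D (D \<Lambda>)) p"
proof -
  \<comment> \<open>The hypotheses place \<open>\<eta> p\<close> in the kernels required of
    \<open>v\<close>. By the product rule the left side differs from the goal only by a term
    containing \<open>D (D h) p = 0\<close>.\<close>
  have "D (\<lambda>q. det_cols (E q) (D (D h) q)) p = b p * D (D (D \<Lambda>)) p"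
    using frechet_derivative_det_DDh[of "\<eta> p"] assms by (simp add: dir_deriv_def)
  then show ?thesis
    by (simp add: D_det_cols smooth_intros p_in DDh_p assms)
qed

end

end

section \<open>Invertibility of Jacobians\<close>

text \<open>A square matrix is invertible iff its kernel is trivial. In this form rows need to be
  compared only on the kernels of earlier rows.\<close>

lemma det_jacobian_vector_3:
  fixes g1 g2 g3 :: "real ^ 3 \<Rightarrow> real"
  assumes "g1 differentiable at p" "g2 differentiable at p" "g3 differentiable at p"
  shows "det (jacobian (\<lambda>q. vector [g1 q, g2 q, g3 q] :: real ^ 3) (at p)) \<noteq> 0 \<longleftrightarrow>
    (\<forall>v. frechet_derivative g1 (at p) v = 0 \<longrightarrow> frechet_derivative g2 (at p) v = 0 \<longrightarrow>
      frechet_derivative g3 (at p) v = 0 \<longrightarrow> v = 0)"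
proof -
  let ?g = "\<lambda>q. vector [g1 q, g2 q, g3 q] :: real ^ 3"
  let ?g' = "\<lambda>v. vector [frechet_derivative g1 (at p) v, frechet_derivative g2 (at p) v,
    frechet_derivative g3 (at p) v] :: real ^ 3"
  have "(?g has_derivative ?g') (at p)"
  proof (subst has_derivative_componentwise_within, intro ballI)
    fix i :: "real ^ 3"
    assume "i \<in> Basis"
    then obtain j where i: "i = axis j 1" by (auto simp: Basis_vec_def)
    show "((\<lambda>q. ?g q \<bullet> i) has_derivative (\<lambda>v. ?g' v \<bullet> i)) (at p)"
      using assms exhaust_3[of j] by (auto simp: i inner_axis frechet_derivative_works)
  qed
  then have "jacobian ?g (at p) *v v = ?g' v" for v
    unfolding jacobian_def frechet_derivative_at[symmetric]
    by (simp add: matrix_works has_derivative_linear frechet_derivative_at[symmetric])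
  moreover have "?g' v = 0 \<longleftrightarrow> frechet_derivative g1 (at p) v = 0 \<and>
      frechet_derivative g2 (at p) v = 0 \<and> frechet_derivative g3 (at p) v = 0" for v
    by (simp add: vec_eq_iff forall_3)
  ultimately show ?thesis
    unfolding invertible_det_nz[symmetric] invertible_left_inverse matrix_left_invertible_ker
    by auto
qed

lemma rank_eq_3_iff_det: "rank (A :: real ^ 3 ^ 3) = 3 \<longleftrightarrow> det A \<noteq> 0"
  using det_eq_0_rank[of A] rank_bound[of A] by auto

section \<open>Planar determinants and rank 2 distributions\<close>

lemma det_cols_eq_0_iff:
  assumes "a \<noteq> 0"
  shows "det_cols a c = 0 \<longleftrightarrow> (\<exists>k. c = k *\<^sub>R a)"
proof
  assume "det_cols a c = 0"
  moreover have "a $ 1 \<noteq> 0 \<or> a $ 2 \<noteq> 0"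
    using assms by (simp add: vec_eq_iff forall_2)
  ultimately have "c = (c $ 1 / a $ 1) *\<^sub>R a \<or> c = (c $ 2 / a $ 2) *\<^sub>R a"
    by (auto simp: det_cols_eq vec_eq_iff forall_2 field_simps)
  then show "\<exists>k. c = k *\<^sub>R a" by blast
qed (auto simp: det_cols_eq)

lemma dim_pair_less_2_iff:
  assumes "a \<noteq> 0"
  shows "dim {a, c} < 2 \<longleftrightarrow> det_cols a c = 0"
proof
  assume "dim {a, c} < 2"
  have "c \<in> span {a}"
  proof (rule ccontr)
    assume "c \<notin> span {a}"
    then have "independent {c, a}" "c \<noteq> a"
      using assms by (auto simp: independent_insert span_base)
    then have "dim {c, a} = 2"
      by (simp add: dim_eq_card_independent)
    then show False
      using \<open>dim {a, c} < 2\<close> by (simp add: insert_commute)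
  qed
  then show "det_cols a c = 0"
    by (auto simp: det_cols_eq_0_iff[OF assms] span_singleton)
next
  assume "det_cols a c = 0"
  then have "{a, c} \<subseteq> span {a}"
    by (auto simp: det_cols_eq_0_iff[OF assms] span_base span_scale)
  then have "dim {a, c} \<le> card {a}"
    by (intro dim_le_card) auto
  then show "dim {a, c} < 2" by simp
qed

lemma independent_pairD:
  fixes x y :: "'a::euclidean_space"
  assumes "independent {x, y}" "x \<noteq> y"
  shows "x \<noteq> 0" "y \<noteq> k *\<^sub>R x"
proof -
  show "x \<noteq> 0" using assms(1) dependent_zero[of "{x, y}"] by auto
  have "y \<notin> span {x}"
    using assms independent_insert[of y "{x}"] by (auto simp: insert_commute)
  then show "y \<noteq> k *\<^sub>R x"
    by (metis insertI1 span_base span_scale)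
qed

text \<open>The vector paired with \<open>v\<close> and \<open>y\<close> in the quotient is the component of \<open>y\<close> orthogonal to
  \<open>x\<close>, scaled by \<open>x \<bullet> x\<close> to avoid a second division.\<close>

definition second_coord :: "'a::euclidean_space \<Rightarrow> 'a \<Rightarrow> 'a \<Rightarrow> real" where
  "second_coord x y v = (v \<bullet> ((x \<bullet> x) *\<^sub>R y - (x \<bullet> y) *\<^sub>R x)) / (y \<bullet> ((x \<bullet> x) *\<^sub>R y - (x \<bullet> y) *\<^sub>R x))"

text \<open>The vector \<open>?w\<close> is orthogonal to \<open>x\<close>. If it were orthogonal to
  \<open>y\<close> too, then, being a combination of both, it would be orthogonal to itself and thus
  0, making \<open>y\<close> a multiple of \<open>x\<close>.\<close>

lemma second_coord_denominator:
  fixes x y :: "'a::euclidean_space"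
  assumes "independent {x, y}" "x \<noteq> y"
  shows "y \<bullet> ((x \<bullet> x) *\<^sub>R y - (x \<bullet> y) *\<^sub>R x) \<noteq> 0"
proof
  let ?w = "(x \<bullet> x) *\<^sub>R y - (x \<bullet> y) *\<^sub>R x"
  assume "y \<bullet> ?w = 0"
  moreover have "x \<bullet> ?w = 0"
    by (simp add: inner_diff_right)
  ultimately have "?w \<bullet> ?w = 0"
    by (simp add: inner_diff_left[of _ _ ?w])
  then have "(x \<bullet> x) *\<^sub>R y = (x \<bullet> y) *\<^sub>R x" by simp
  then have "y = ((x \<bullet> y) / (x \<bullet> x)) *\<^sub>R x"
    using independent_pairD(1)[OF assms]
    by (metis (no_types, lifting) divide_inverse_commute inner_eq_zero_iff scaleR_one scaleR_scaleR left_inverse)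
  then show False
    using independent_pairD(2)[OF assms] by blast
qed

lemma second_coord_eq:
  fixes x y :: "'a::euclidean_space"
  assumes "independent {x, y}" "x \<noteq> y"
  shows "second_coord x y (a *\<^sub>R x + c *\<^sub>R y) = c"
proof -
  let ?w = "(x \<bullet> x) *\<^sub>R y - (x \<bullet> y) *\<^sub>R x"
  have "x \<bullet> ?w = 0"
    by (simp add: inner_diff_right)
  then show ?thesis
    using second_coord_denominator[OF assms]
    by (simp add: second_coord_def inner_add_left)
qed

text \<open>The purpose of the explicit quotient: the \<open>e2\<close> coefficient of \<eta>
  becomes visibly smooth.\<close>

lemma smooth_on_second_coord:
  assumes "open U" "smooth_on x U" "smooth_on y U" "smooth_on v U"
    and "\<And>q. q \<in> U \<Longrightarrow> independent {x q, y q} \<and> x q \<noteq> y q"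
  shows "smooth_on (\<lambda>q. second_coord (x q) (y q) (v q)) U"
  unfolding second_coord_def
  using assms second_coord_denominator
  by (intro smooth_on_divide smooth_on_diff bounded_bilinear.smooth_on[OF bounded_bilinear_inner]
      bounded_bilinear.smooth_on[OF bounded_bilinear_scaleR]) blast+

lemma rank2_distribution_with_frame_memE:
  assumes "rank2_distribution_with_frame M D e1 e2" "q \<in> M" "v \<in> D q"
  obtains a where "v = a *\<^sub>R e1 q + second_coord (e1 q) (e2 q) v *\<^sub>R e2 q"
proof -
  have "v \<in> span {e1 q, e2 q}" and ind: "independent {e1 q, e2 q}" "e1 q \<noteq> e2 q"
    using assms by (auto simp: rank2_distribution_with_frame_def)
  then obtain a c where "v = a *\<^sub>R e1 q + c *\<^sub>R e2 q"
    by (auto simp: span_insert span_singleton algebra_simps)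
  then show thesis
    using that second_coord_eq[OF ind] by metis
qed

text \<open>The image of the fibre is spanned by the two columns of the matrix of the homomorphism.
  This identifies the singular set with the zero set on which \<open>h_eq_0\<close> is
  required.\<close>

lemma hom_rank_less_2_iff:
  assumes "f differentiable at q" "D q = span {e1 q, e2 q}" "dir_deriv e1 f q \<noteq> 0"
  shows "hom_rank f D q < 2 \<longleftrightarrow> lambda_hom f e1 e2 q = 0"
proof -
  have "frechet_derivative f (at q) ` D q = span {dir_deriv e1 f q, dir_deriv e2 f q}"
    using linear_span_image[OF linear_frechet_derivative[OF assms(1)], of "{e1 q, e2 q}"]
    by (simp add: assms(2) dir_deriv_def)
  then show ?thesis
    by (simp add: hom_rank_def lambda_hom_def dim_pair_less_2_iff[OF assms(3)])
qed

text \<open>Otherwise \<open>\<eta> p\<close> is a multiple of \<open>e1 p\<close> killed by the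
  derivative of \<open>f\<close>, hence 0, and the kernel is trivial. But a vanishing determinant
  makes \<open>e2 p - k *\<^sub>R e1 p\<close> a nonzero kernel vector for some
  \<open>k\<close>.\<close>

lemma null_section_second_coord_nonzero:
  assumes frame: "rank2_distribution_with_frame M D e1 e2" and null: "null_section M f D p U \<eta>"
    and diff: "f differentiable at p" and e1f: "dir_deriv e1 f p \<noteq> 0"
    and lam: "lambda_hom f e1 e2 p = 0"
  shows "second_coord (e1 p) (e2 p) (\<eta> p) \<noteq> 0"
proof
  assume 0: "second_coord (e1 p) (e2 p) (\<eta> p) = 0"
  note lin = linear_frechet_derivative[OF diff]
  have p: "p \<in> M" "\<eta> p \<in> D p" "span {\<eta> p} = hom_ker f D p"
    using null by (auto simp: null_section_def corank_one_def singular_set_def)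
  have ind: "independent {e1 p, e2 p}" "e1 p \<noteq> e2 p" "D p = span {e1 p, e2 p}"
    using frame p by (auto simp: rank2_distribution_with_frame_def)
  obtain a where a: "\<eta> p = a *\<^sub>R e1 p"
    using rank2_distribution_with_frame_memE[OF frame p(1,2)] 0 by auto
  have "frechet_derivative f (at p) (\<eta> p) = 0"
    using p(3) span_base[of "\<eta> p" "{\<eta> p}"] by (auto simp: hom_ker_def)
  then have "a = 0"
    using e1f by (simp add: a linear_scale[OF lin] dir_deriv_def)
  then have "hom_ker f D p = {0}"
    using p(3) a by simp
  obtain k where k: "dir_deriv e2 f p = k *\<^sub>R dir_deriv e1 f p"
    using lam e1f by (auto simp: lambda_hom_def det_cols_eq_0_iff)
  have "e2 p - k *\<^sub>R e1 p \<in> D p"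
    unfolding ind(3) by (intro span_diff span_scale span_base) auto
  then have "e2 p - k *\<^sub>R e1 p \<in> hom_ker f D p"
    using k by (simp add: hom_ker_def dir_deriv_def linear_diff[OF lin] linear_scale[OF lin])
  then show False
    using \<open>hom_ker f D p = {0}\<close> independent_pairD(2)[OF ind(1,2), of k] by auto
qed

section \<open>The fold, cusp and swallowtail criteria\<close>

lemma funpow_2_3_4:
  "(F ^^ 2) x = F (F x)" "(F ^^ 3) x = F (F (F x))" "(F ^^ 4) x = F (F (F (F x)))"
  by (simp_all add: eval_nat_numeral)

theorem proposition4p1:
  fixes M U :: "(real ^ 3) set"
    and f :: "real ^ 3 \<Rightarrow> real ^ 2"
    and D :: "real ^ 3 \<Rightarrow> (real ^ 3) set"
    and e1 e2 \<eta> :: "real ^ 3 \<Rightarrow> real ^ 3"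
    and p :: "real ^ 3"
  assumes "open M" and "0 \<in> M"
    and "smooth_on f M"
    and "rank2_distribution_with_frame M D e1 e2"
    and "\<forall>q\<in>M. dir_deriv e1 f q \<noteq> 0"
    and "p \<in> singular_set M f D"
    and "null_section M f D p U \<eta>"
  shows "(fold_like M f D e1 e2 \<eta> p \<longleftrightarrow>
            det_cols (dir_deriv e1 f p) ((dir_deriv \<eta> ^^ 2) f p) \<noteq> 0)
       \<and> (non_degenerate M f D e1 e2 p \<longrightarrow>
           (cusp_like M f D e1 e2 \<eta> p \<longleftrightarrow>
              det_cols (dir_deriv e1 f p) ((dir_deriv \<eta> ^^ 2) f p) = 0
            \<and> det_cols (dir_deriv e1 f p) ((dir_deriv \<eta> ^^ 3) f p) \<noteq> 0))
       \<and> (non_degenerate M f D e1 e2 p \<longrightarrow>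
           (swallowtail_like M f D e1 e2 \<eta> p \<longleftrightarrow>
              det_cols (dir_deriv e1 f p) ((dir_deriv \<eta> ^^ 2) f p) = 0
            \<and> det_cols (dir_deriv e1 f p) ((dir_deriv \<eta> ^^ 3) f p) = 0
            \<and> det_cols (dir_deriv e1 f p) ((dir_deriv \<eta> ^^ 4) f p) \<noteq> 0
            \<and> det (jacobian (\<lambda>q. vector
                     [det_cols (dir_deriv e1 f q) (dir_deriv \<eta> f q),
                      det_cols (dir_deriv e1 f q) ((dir_deriv \<eta> ^^ 2) f q),
                      det_cols (dir_deriv e1 f q) ((dir_deriv \<eta> ^^ 3) f q)] :: real ^ 3) (at p)) \<noteq> 0))"

proof -
  note [simp] = funpow_2_3_4
  let ?\<Lambda> = "lambda_hom f e1 e2" and ?E = "dir_deriv e1 f" and ?h = "dir_deriv \<eta> f"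
  let ?b = "\<lambda>q. second_coord (e1 q) (e2 q) (\<eta> q)"
  have U: "open U" "p \<in> U" "U \<subseteq> M" "smooth_on \<eta> U" "corank_one M f D p"
    and \<eta>_in: "\<And>q. q \<in> U \<Longrightarrow> \<eta> q \<in> D q"
    and \<eta>_ker: "\<And>q. q \<in> singular_set M f D \<Longrightarrow> q \<in> U \<Longrightarrow> span {\<eta> q} = hom_ker f D q"
    using assms(7) by (auto simp: null_section_def)
  have frame: "smooth_on e1 U" "smooth_on e2 U"
    "\<And>q. q \<in> U \<Longrightarrow> independent {e1 q, e2 q} \<and> e1 q \<noteq> e2 q" "\<And>q. q \<in> U \<Longrightarrow> D q = span {e1 q, e2 q}"
    using assms(4) U(3) smooth_on_subset by (auto simp: rank2_distribution_with_frame_def)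
  have smooth_f: "smooth_on f U"
    using assms(3) U(3) by (rule smooth_on_subset)
  have E_nz: "?E q \<noteq> 0" if "q \<in> U" for q
    using assms(5) U(3) that by blast
  have diff_f: "f differentiable at q" if "q \<in> U" for q
    using smooth_f that by (rule smooth_on_differentiable)
  have singular: "q \<in> singular_set M f D \<longleftrightarrow> ?\<Lambda> q = 0" if "q \<in> U" for q
    using hom_rank_less_2_iff[of f q D e1 e2] diff_f E_nz frame(4) that U(3)
    by (auto simp: singular_set_def)
  have smooth_\<Lambda>: "smooth_on ?\<Lambda> U"
    unfolding lambda_hom_def
    by (intro bounded_bilinear.smooth_on[OF bounded_bilinear_det_cols] smooth_on_dir_deriv
        U(1) smooth_f frame(1,2))
  \<comment> \<open>Since \<open>?h\<close> is already the first derivative of \<open>f\<close>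
    along \<eta>, the i-th derivative of \<open>f\<close> in the criteria is the (i-1)-st derivative
    of \<open>?h\<close>.\<close>
  interpret null_direction U p ?\<Lambda> ?b \<eta> ?E ?h
  proof
    show "smooth_on ?b U"
      using U(1) frame(1,2) U(4) frame(3) by (rule smooth_on_second_coord)
    show "?h q = 0" if "q \<in> U" "?\<Lambda> q = 0" for q
      using \<eta>_ker[of q] singular[of q] that span_base[of "\<eta> q" "{\<eta> q}"]
      by (auto simp: hom_ker_def dir_deriv_def)
    \<comment> \<open>The \<open>e1\<close> part of \<eta> contributes a multiple of
      \<open>?E q\<close> to \<open>?h q\<close>, which the determinant against \<open>?E q\<close>
      cancels.\<close>
    show "det_cols (?E q) (?h q) = ?b q * ?\<Lambda> q" if q: "q \<in> U" for q
    proof -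
      have "q \<in> M" using q U(3) by blast
      then obtain a where a: "\<eta> q = a *\<^sub>R e1 q + ?b q *\<^sub>R e2 q"
        by (rule rank2_distribution_with_frame_memE[OF assms(4) _ \<eta>_in[OF q]])
      note lin = linear_frechet_derivative[OF diff_f[OF q]]
      have "?h q = a *\<^sub>R ?E q + ?b q *\<^sub>R dir_deriv e2 f q"
        unfolding dir_deriv_def
        using arg_cong[OF a, of "frechet_derivative f (at q)"]
        by (simp only: linear_add[OF lin] linear_scale[OF lin])
      then show ?thesis
        by (simp add: lambda_hom_def det_cols_eq algebra_simps)
    qed
  qed (use U singular assms(6) smooth_\<Lambda> smooth_f frame smooth_on_dir_deriv in auto)
  have b: "?b p \<noteq> 0"
    using null_section_second_coord_nonzero[OF assms(4,7) diff_f E_nz] U(2) singular assms(6) by blast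
  show ?thesis
  proof (intro conjI impI)
    show "fold_like M f D e1 e2 \<eta> p \<longleftrightarrow> det_cols (?E p) ((dir_deriv \<eta> ^^ 2) f p) \<noteq> 0"
      using b U(5) by (simp add: fold_like_def det_Dh_p)
  next
    assume nd: "non_degenerate M f D e1 e2 p"
    then have nd': "frechet_derivative ?\<Lambda> (at p) \<noteq> (\<lambda>v. 0)"
      by (simp add: non_degenerate_def)
    show "cusp_like M f D e1 e2 \<eta> p \<longleftrightarrow>
        det_cols (?E p) ((dir_deriv \<eta> ^^ 2) f p) = 0 \<and>
        det_cols (?E p) ((dir_deriv \<eta> ^^ 3) f p) \<noteq> 0"
      using b nd det_DDh_p[OF nd'] by (auto simp: cusp_like_def det_Dh_p)
  next
    assume nd: "non_degenerate M f D e1 e2 p"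
    then have nd': "frechet_derivative ?\<Lambda> (at p) \<noteq> (\<lambda>v. 0)"
      by (simp add: non_degenerate_def)
    let ?J = "jacobian (\<lambda>q. vector [?\<Lambda> q, dir_deriv \<eta> ?\<Lambda> q, dir_deriv \<eta> (dir_deriv \<eta> ?\<Lambda>) q] :: real ^ 3) (at p)"
    let ?K = "jacobian (\<lambda>q. vector [det_cols (?E q) (?h q), det_cols (?E q) (dir_deriv \<eta> ?h q),
      det_cols (?E q) (dir_deriv \<eta> (dir_deriv \<eta> ?h) q)] :: real ^ 3) (at p)"
    have J: "det ?J \<noteq> 0 \<longleftrightarrow> (\<forall>v. frechet_derivative ?\<Lambda> (at p) v = 0 \<longrightarrow>
        frechet_derivative (dir_deriv \<eta> ?\<Lambda>) (at p) v = 0 \<longrightarrow> frechet_derivative (dir_deriv \<eta> (dir_deriv \<eta> ?\<Lambda>)) (at p) v = 0 \<longrightarrow> v = 0)"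
      by (intro det_jacobian_vector_3 differentiable smooth_intros U(2))
    have K: "det ?K \<noteq> 0 \<longleftrightarrow> (\<forall>v. frechet_derivative (\<lambda>q. det_cols (?E q) (?h q)) (at p) v = 0 \<longrightarrow>
        frechet_derivative (\<lambda>q. det_cols (?E q) (dir_deriv \<eta> ?h q)) (at p) v = 0 \<longrightarrow>
        frechet_derivative (\<lambda>q. det_cols (?E q) (dir_deriv \<eta> (dir_deriv \<eta> ?h) q)) (at p) v = 0 \<longrightarrow> v = 0)"
      by (intro det_jacobian_vector_3 differentiable smooth_intros U(2))
    \<comment> \<open>Because \<open>b\<close> is nonzero at \<open>p\<close>, the row comparisons
      turn one kernel condition into the other, one row after another.\<close>
    have JK: "det ?J \<noteq> 0 \<longleftrightarrow> det ?K \<noteq> 0" if "dir_deriv \<eta> ?\<Lambda> p = 0" "dir_deriv \<eta> (dir_deriv \<eta> ?\<Lambda>) p = 0"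
      unfolding J K using that b nd'
      by (auto simp: frechet_derivative_det_h frechet_derivative_det_Dh frechet_derivative_det_DDh)
    \<comment> \<open>This vector tests the kernel of \<open>?J\<close>: the first two rows
      annihilate it, so by invertibility the third cannot. Hence the third derivative of \<Lambda>
      is nonzero, a condition that the definition of swallowtail-like leaves implicit.\<close>
    have "\<eta> p \<noteq> 0"
      using b by (auto simp: second_coord_def)
    then have DDD: "dir_deriv \<eta> (dir_deriv \<eta> (dir_deriv \<eta> ?\<Lambda>)) p \<noteq> 0" if "dir_deriv \<eta> ?\<Lambda> p = 0" "dir_deriv \<eta> (dir_deriv \<eta> ?\<Lambda>) p = 0" "det ?J \<noteq> 0"
      using that unfolding J by (auto simp: dir_deriv_def)
    show "swallowtail_like M f D e1 e2 \<eta> p \<longleftrightarrow>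
        det_cols (?E p) ((dir_deriv \<eta> ^^ 2) f p) = 0 \<and>
        det_cols (?E p) ((dir_deriv \<eta> ^^ 3) f p) = 0 \<and>
        det_cols (?E p) ((dir_deriv \<eta> ^^ 4) f p) \<noteq> 0 \<and>
        det (jacobian (\<lambda>q. vector
          [det_cols (?E q) (?h q), det_cols (?E q) ((dir_deriv \<eta> ^^ 2) f q),
           det_cols (?E q) ((dir_deriv \<eta> ^^ 3) f q)] :: real ^ 3) (at p)) \<noteq> 0"
    proof -
      have swallowtail: "swallowtail_like M f D e1 e2 \<eta> p \<longleftrightarrow>
          dir_deriv \<eta> ?\<Lambda> p = 0 \<and> dir_deriv \<eta> (dir_deriv \<eta> ?\<Lambda>) p = 0 \<and> det ?J \<noteq> 0"
        using nd by (simp add: swallowtail_like_def rank_eq_3_iff_det)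
      have d1: "det_cols (?E p) (dir_deriv \<eta> ?h p) = 0 \<longleftrightarrow> dir_deriv \<eta> ?\<Lambda> p = 0"
        using b by (simp add: det_Dh_p)
      \<comment> \<open>Each equivalence presupposes the vanishing of the earlier derivatives of
        \<Lambda>, so they are chained in this order.\<close>
      have d2: "det_cols (?E p) (dir_deriv \<eta> (dir_deriv \<eta> ?h) p) = 0 \<longleftrightarrow>
          dir_deriv \<eta> (dir_deriv \<eta> ?\<Lambda>) p = 0"
        if "dir_deriv \<eta> ?\<Lambda> p = 0"
        using b that by (simp add: det_DDh_p[OF nd'])
      have d3: "det_cols (?E p) (dir_deriv \<eta> (dir_deriv \<eta> (dir_deriv \<eta> ?h)) p) = 0 \<longleftrightarrow>
          dir_deriv \<eta> (dir_deriv \<eta> (dir_deriv \<eta> ?\<Lambda>)) p = 0"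
        if "dir_deriv \<eta> ?\<Lambda> p = 0" "dir_deriv \<eta> (dir_deriv \<eta> ?\<Lambda>) p = 0"
        using b that by (simp add: det_DDDh_p[OF nd'])
      show ?thesis
        unfolding swallowtail funpow_2_3_4 using d1 d2 d3 JK DDD by argo
    qed
  qed
qed

end
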